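(* Let $(M,L)$ be a Finsler manifold of dimension $n\ge 3$ with non-zero horizontal Ricci tensor $\mathrm{Ric}$ satisfying $\mathrm{Ric}=\frac{r}{n}\,g$. Then the following three properties are equivalent: (i) $(M,L)$ is concircularly recurrent; (ii) $(M,L)$ is projectively recurrent; (iii) $(M,L)$ is m-projectively recurrent.
   Context: Setting. $(M,L)$ is a smooth Finsler manifold of dimension $n$ (with positive definite Finsler metric), $\mathcal{T}M$ is the bundle of nonzero tangent vectors, $\pi:\mathcal{T}M\to M$, and $\pi^{-1}(TM)\to\mathcal{T}M$ is the pullback bundle, whose sections $\overline X$ are called $\pi$-vector fields (1-forms on this bundle are $\pi$-forms). $g$ is the Finsler metric on $\pi^{-1}(TM)$ defined by $L$ (in coordinates $g_{ij}=\frac12\partial^2L^2/\partial y^i\partial y^j$). $\overline\eta(u)=(u,u)$ is the fundamental $\pi$-vector field. $\rho:T(\mathcal{T}M)\to\pi^{-1}(TM)$ is the morphism induced by $d\pi$ and $\gamma:\pi^{-1}(TM)\to T(\mathcal{T}M)$ is the vertical lift. A linear connection $D$ on $\pi^{-1}(TM)$ is regular if $T_u(\mathcal{T}M)=V_u\oplus H_u$ for all $u$, where $V_u=\ker d\pi$ and $H_u=\{X: D_X\overline\eta=0\}$; then $\beta:=(\rho|_{H})^{-1}$ is its horizontal map. The Cartan connection $\nabla$ is the unique regular connection with $\nabla g=0$, $Q(\overline X,\overline Y):=\mathbf T(\beta\overline X,\beta\overline Y)=0$, and $T(\overline X,\overline Y):=\mathbf T(\gamma\overline X,\beta\overline Y)$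 satisfying $g(T(\overline X,\overline Y),\overline Z)=g(T(\overline X,\overline Z),\overline Y)$, where $\mathbf T(X,Y)=\nabla_X\rho Y-\nabla_Y\rho X-\rho[X,Y]$. Curvature. $\mathbf K(X,Y)\overline Z=-\nabla_X\nabla_Y\overline Z+\nabla_Y\nabla_X\overline Z+\nabla_{[X,Y]}\overline Z$; $R(\overline X,\overline Y)\overline Z=\mathbf K(\beta\overline X,\beta\overline Y)\overline Z$. The horizontal Ricci tensor is $\mathrm{Ric}(\overline X,\overline Y)=\mathrm{trace}\{\overline Z\mapsto R(\overline X,\overline Z)\overline Y\}$; $\mathrm{Ric}_o$ is the $(1,1)$ tensor with $g(\mathrm{Ric}_o\overline X,\overline Y)=\mathrm{Ric}(\overline X,\overline Y)$; $r=\mathrm{trace}\,\mathrm{Ric}_o$ is the horizontal scalar curvature. With $G(\overline X,\overline Y)\overline Z=g(\overline X,\overline Z)\overline Y-g(\overline Y,\overline Z)\overline X$ define: the concircular curvature tensor $C=R-\frac{r}{n(n-1)}G$; the projective curvature tensor $\mathbb P(\overline X,\overline Y)\overline Z=R(\overline X,\overline Y)\overline Z-\frac1{n-1}\{\mathrm{Ric}(\overline X,\overline Z)\overline Y-\mathrm{Ric}(\overline Y,\overline Z)\overline X\}$; the m-projective curvature tensor $\mathbb H(\overline X,\overline Y)\overline Z=R(\overline X,\overline Y)\overline Z-\frac{1}{2(n-1)}\{\mathrm{Ric}(\overline X,\overline Z)\overline Y-\mathrm{Ric}(\overline Y,\overline Z)\overline X+g(\overline X,\overline Z)\mathrm{Ric}_o\overline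 Y-g(\overline Y,\overline Z)\mathrm{Ric}_o\overline X\}$. Recurrence. The $h$-covariant derivative of a $\pi$-tensor field $B$ is $(\stackrel{h}{\nabla}B)(\overline W,\dots)=(\nabla_{\beta\overline W}B)(\dots)$. $(M,L)$ is concircularly recurrent (resp. projectively recurrent, m-projectively recurrent) if $\stackrel{h}{\nabla}C=A\otimes C$ (resp. $\stackrel{h}{\nabla}\mathbb P=A\otimes\mathbb P$, $\stackrel{h}{\nabla}\mathbb H=A\otimes\mathbb H$) for some non-zero $\pi$-form $A$. *)

theory Defs
  imports "HOL-Analysis.Analysis" "HOL-Library.Function_Algebras"
begin

instantiation "fun" :: (type, scaleR) scaleR
begin
definition scaleR_fun :: "real \<Rightarrow> ('a \<Rightarrow> 'b) \<Rightarrow> 'a \<Rightarrow> 'b"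
  where "scaleR_fun c f = (\<lambda>x. c *\<^sub>R f x)"
instance ..
end

instance "fun" :: (type, real_vector) real_vector
  by standard (auto simp: scaleR_fun_def scaleR_add_right scaleR_add_left)


section \<open>Smooth manifolds\<close>

text \<open>Meaningful for open \<open>S\<close>: \<open>f\<close> is of class \<open>C\<^sup>k\<close> on \<open>S\<close>.\<close>

primrec Ck_on :: "nat \<Rightarrow> 'e set \<Rightarrow> ('e::euclidean_space \<Rightarrow> 'f::euclidean_space) \<Rightarrow> bool" where
  "Ck_on 0 S f \<longleftrightarrow> continuous_on S f"
| "Ck_on (Suc k) S f \<longleftrightarrow> (\<forall>x\<in>S. f differentiable (at x)) \<and>
     (\<forall>v. Ck_on k S (\<lambda>x. frechet_derivative f (at x) v))"

definition smooth_on :: "'e set \<Rightarrow> ('e::euclidean_space \<Rightarrow> 'f::euclidean_space) \<Rightarrow> bool" where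
  "smooth_on S f \<longleftrightarrow> (\<forall>k. Ck_on k S f)"

text \<open>A manifold is given by its atlas alone, a set of pairs of a domain and a coordinate map; the
  carrier is the union of the domains and the topology is the one induced by the charts. The
  dimension is \<open>DIM('e)\<close>.\<close>

type_synonym ('a, 'e) atlas = "('a set \<times> ('a \<Rightarrow> 'e)) set"

definition carrier :: "('a, 'e) atlas \<Rightarrow> 'a set" where
  "carrier M = (\<Union>(U, \<phi>)\<in>M. U)"

definition mtop :: "('a, 'e::euclidean_space) atlas \<Rightarrow> 'a topology" where
  "mtop M = topology (\<lambda>W. W \<subseteq> carrier M \<and> (\<forall>(U, \<phi>)\<in>M. open (\<phi> ` (U \<inter> W))))"

definition smooth_manifold :: "('a, 'e::euclidean_space) atlas \<Rightarrow> bool" where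
  "smooth_manifold M \<longleftrightarrow>
     (\<forall>(U, \<phi>)\<in>M. inj_on \<phi> U) \<and>
     (\<forall>(U, \<phi>)\<in>M. \<forall>(V, \<psi>)\<in>M.
        open (\<phi> ` (U \<inter> V)) \<and> smooth_on (\<phi> ` (U \<inter> V)) (\<psi> \<circ> inv_into U \<phi>)) \<and>
     Hausdorff_space (mtop M) \<and> second_countable (mtop M)"

definition smooth_fun_on :: "('a, 'e::euclidean_space) atlas \<Rightarrow> 'a set \<Rightarrow> ('a \<Rightarrow> real) \<Rightarrow> bool" where
  "smooth_fun_on M W f \<longleftrightarrow> (\<forall>(U, \<phi>)\<in>M. smooth_on (\<phi> ` (U \<inter> W)) (f \<circ> inv_into U \<phi>))"

definition smooth_at :: "('a, 'e::euclidean_space) atlas \<Rightarrow> ('a \<Rightarrow> real) \<Rightarrow> 'a \<Rightarrow> bool" where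
  "smooth_at M f p \<longleftrightarrow> (\<exists>W. openin (mtop M) W \<and> p \<in> W \<and> smooth_fun_on M W f)"

text \<open>Tangent vectors at \<open>p\<close> are the directional derivative operators on functions that are smooth
  near \<open>p\<close>, extended by \<open>0\<close> to all other functions. With this convention a tangent vector is
  determined as a functional on the whole type, and the tangent space is a linear subspace.\<close>

type_synonym 'a tangent = "('a \<Rightarrow> real) \<Rightarrow> real"

definition tangent_space :: "('a, 'e::euclidean_space) atlas \<Rightarrow> 'a \<Rightarrow> 'a tangent set" where
  "tangent_space M p = {v. \<exists>(U, \<phi>)\<in>M. p \<in> U \<and> (\<exists>w. v =
     (\<lambda>f. if smooth_at M f p then frechet_derivative (f \<circ> inv_into U \<phi>) (at (\<phi> p)) w else 0))}"

definition vector_field :: "('a, 'e::euclidean_space) atlas \<Rightarrow> ('a \<Rightarrow> 'a tangent) \<Rightarrow> bool" where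
  "vector_field M X \<longleftrightarrow>
     (\<forall>p\<in>carrier M. X p \<in> tangent_space M p) \<and> (\<forall>p. p \<notin> carrier M \<longrightarrow> X p = 0) \<and>
     (\<forall>(U, \<phi>)\<in>M. \<forall>b\<in>Basis. smooth_fun_on M U (\<lambda>p. X p (\<lambda>q. \<phi> q \<bullet> b)))"

definition lie_bracket ::
  "('a, 'e::euclidean_space) atlas \<Rightarrow> ('a \<Rightarrow> 'a tangent) \<Rightarrow> ('a \<Rightarrow> 'a tangent) \<Rightarrow> 'a \<Rightarrow> 'a tangent" where
  "lie_bracket M X Y = (\<lambda>p f. if p \<in> carrier M \<and> smooth_at M f p
     then X p (\<lambda>q. Y q f) - Y p (\<lambda>q. X q f) else 0)"


section \<open>The slit tangent bundle and the pullback bundle\<close>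

text \<open>Points of the slit tangent bundle are pairs \<open>(p, v)\<close> with \<open>v \<noteq> 0\<close> tangent at \<open>p\<close>. Its charts
  are \<open>(p, v) \<mapsto> (\<phi> p, (v \<phi>\<^sup>1, \<dots>, v \<phi>\<^sup>n))\<close>.\<close>

type_synonym 'a tm = "'a \<times> 'a tangent"

definition slit :: "('a, 'e::euclidean_space) atlas \<Rightarrow> 'a tm set" where
  "slit M = {(p, v). p \<in> carrier M \<and> v \<in> tangent_space M p \<and> v \<noteq> 0}"

definition slit_atlas :: "('a, 'e::euclidean_space) atlas \<Rightarrow> ('a tm, 'e \<times> 'e) atlas" where
  "slit_atlas M = (\<lambda>(U, \<phi>). ({u\<in>slit M. fst u \<in> U},
     \<lambda>(p, v). (\<phi> p, \<Sum>b\<in>Basis. v (\<lambda>q. \<phi> q \<bullet> b) *\<^sub>R b))) ` M"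

text \<open>The fibre of the pullback bundle over \<open>u\<close> is identified with the tangent space at \<open>fst u\<close>. A
  \<open>\<pi>\<close>-vector field is a smooth section of the pullback bundle, set to \<open>0\<close> off the slit tangent
  bundle.\<close>

type_synonym 'a pisection = "'a tm \<Rightarrow> 'a tangent"
type_synonym 'a tfield = "'a tm \<Rightarrow> 'a tm tangent"

abbreviation fibre :: "('a, 'e::euclidean_space) atlas \<Rightarrow> 'a tm \<Rightarrow> 'a tangent set" where
  "fibre M u \<equiv> tangent_space M (fst u)"

abbreviation ttm :: "('a, 'e::euclidean_space) atlas \<Rightarrow> 'a tm \<Rightarrow> 'a tm tangent set" where
  "ttm M u \<equiv> tangent_space (slit_atlas M) u"

definition pi_field :: "('a, 'e::euclidean_space) atlas \<Rightarrow> 'a pisection \<Rightarrow> bool" where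
  "pi_field M X \<longleftrightarrow>
     (\<forall>u\<in>slit M. X u \<in> fibre M u) \<and> (\<forall>u. u \<notin> slit M \<longrightarrow> X u = 0) \<and>
     (\<forall>(U, \<phi>)\<in>M. \<forall>b\<in>Basis.
        smooth_fun_on (slit_atlas M) {u\<in>slit M. fst u \<in> U} (\<lambda>u. X u (\<lambda>q. \<phi> q \<bullet> b)))"

definition pi_form :: "('a, 'e::euclidean_space) atlas \<Rightarrow> ('a tm \<Rightarrow> 'a tangent \<Rightarrow> real) \<Rightarrow> bool" where
  "pi_form M A \<longleftrightarrow>
     (\<forall>u\<in>slit M. \<forall>x\<in>fibre M u. \<forall>y\<in>fibre M u. A u (x + y) = A u x + A u y) \<and>
     (\<forall>u\<in>slit M. \<forall>x\<in>fibre M u. \<forall>c. A u (c *\<^sub>R x) = c * A u x) \<and>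
     (\<forall>X. pi_field M X \<longrightarrow> smooth_fun_on (slit_atlas M) (slit M) (\<lambda>u. A u (X u)))"

definition fundamental :: "('a, 'e::euclidean_space) atlas \<Rightarrow> 'a pisection" where
  "fundamental M = (\<lambda>u. if u \<in> slit M then snd u else 0)"

text \<open>The differential of the projection at \<open>u\<close>.\<close>

definition rho :: "('a, 'e::euclidean_space) atlas \<Rightarrow> 'a tm \<Rightarrow> 'a tm tangent \<Rightarrow> 'a tangent" where
  "rho M u \<xi> = (\<lambda>f. if smooth_at M f (fst u) then \<xi> (f \<circ> fst) else 0)"

text \<open>The vertical lift of \<open>x\<close> at \<open>(p, v)\<close> is the velocity at \<open>t = 0\<close> of \<open>t \<mapsto> (p, v + t x)\<close>.\<close>

definition vlift :: "('a, 'e::euclidean_space) atlas \<Rightarrow> 'a tm \<Rightarrow> 'a tangent \<Rightarrow> 'a tm tangent" where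
  "vlift M u x = (\<lambda>F. if smooth_at (slit_atlas M) F u
     then deriv (\<lambda>t. F (fst u, snd u + t *\<^sub>R x)) 0 else 0)"


section \<open>Finsler structures\<close>

text \<open>The bilinear form on the fibre over \<open>u = (p, v)\<close> with components
  \<open>\<onehalf> \<partial>\<^sup>2L\<^sup>2/\<partial>y\<^sup>i\<partial>y\<^sup>j\<close>, written as a mixed second directional derivative along the fibre.\<close>

definition fmetric :: "('a tm \<Rightarrow> real) \<Rightarrow> 'a tm \<Rightarrow> 'a tangent \<Rightarrow> 'a tangent \<Rightarrow> real" where
  "fmetric L u x y =
     deriv (\<lambda>s. deriv (\<lambda>t. (L (fst u, snd u + s *\<^sub>R x + t *\<^sub>R y))\<^sup>2) 0) 0 / 2"

definition finsler_manifold :: "('a, 'e::euclidean_space) atlas \<Rightarrow> ('a tm \<Rightarrow> real) \<Rightarrow> bool" where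
  "finsler_manifold M L \<longleftrightarrow> smooth_manifold M \<and>
     (\<forall>u\<in>slit M. L u > 0) \<and> (\<forall>p\<in>carrier M. L (p, 0) = 0) \<and>
     (\<forall>(p, v)\<in>slit M. \<forall>c>0. L (p, c *\<^sub>R v) = c * L (p, v)) \<and>
     smooth_fun_on (slit_atlas M) (slit M) L \<and>
     (\<forall>u\<in>slit M. \<forall>x\<in>fibre M u. x \<noteq> 0 \<longrightarrow> fmetric L u x x > 0)"


section \<open>Connections on the pullback bundle\<close>

text \<open>A connection is a map \<open>D u \<xi> Z\<close> giving the derivative at \<open>u\<close> of the section \<open>Z\<close> in the
  direction \<open>\<xi>\<close> tangent to the slit tangent bundle at \<open>u\<close>; \<open>cov M D X Z\<close> is the section \<open>D\<^sub>X Z\<close>.\<close>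

type_synonym 'a connection = "'a tm \<Rightarrow> 'a tm tangent \<Rightarrow> 'a pisection \<Rightarrow> 'a tangent"

definition cov ::
  "('a, 'e::euclidean_space) atlas \<Rightarrow> 'a connection \<Rightarrow> 'a tfield \<Rightarrow> 'a pisection \<Rightarrow> 'a pisection" where
  "cov M D X Z = (\<lambda>u. if u \<in> slit M then D u (X u) Z else 0)"

definition linear_connection :: "('a, 'e::euclidean_space) atlas \<Rightarrow> 'a connection \<Rightarrow> bool" where
  "linear_connection M D \<longleftrightarrow>
     (\<forall>X Z. vector_field (slit_atlas M) X \<longrightarrow> pi_field M Z \<longrightarrow> pi_field M (cov M D X Z)) \<and>
     (\<forall>u\<in>slit M. \<forall>\<xi>\<in>ttm M u. \<forall>Z. pi_field M Z \<longrightarrow>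
        D u \<xi> Z \<in> fibre M u \<and>
        (\<forall>\<zeta>\<in>ttm M u. D u (\<xi> + \<zeta>) Z = D u \<xi> Z + D u \<zeta> Z) \<and>
        (\<forall>c. D u (c *\<^sub>R \<xi>) Z = c *\<^sub>R D u \<xi> Z) \<and>
        (\<forall>W. pi_field M W \<longrightarrow> D u \<xi> (Z + W) = D u \<xi> Z + D u \<xi> W) \<and>
        (\<forall>f. smooth_fun_on (slit_atlas M) (slit M) f \<longrightarrow>
           D u \<xi> (\<lambda>w. f w *\<^sub>R Z w) = \<xi> f *\<^sub>R Z u + f u *\<^sub>R D u \<xi> Z))"

definition vspace :: "('a, 'e::euclidean_space) atlas \<Rightarrow> 'a tm \<Rightarrow> 'a tm tangent set" where
  "vspace M u = {\<xi>\<in>ttm M u. rho M u \<xi> = 0}"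

definition hspace ::
  "('a, 'e::euclidean_space) atlas \<Rightarrow> 'a connection \<Rightarrow> 'a tm \<Rightarrow> 'a tm tangent set" where
  "hspace M D u = {\<xi>\<in>ttm M u. D u \<xi> (fundamental M) = 0}"

definition regular_connection :: "('a, 'e::euclidean_space) atlas \<Rightarrow> 'a connection \<Rightarrow> bool" where
  "regular_connection M D \<longleftrightarrow> linear_connection M D \<and>
     (\<forall>u\<in>slit M. vspace M u \<inter> hspace M D u = {0} \<and>
        ttm M u = {\<xi> + \<zeta> | \<xi> \<zeta>. \<xi> \<in> vspace M u \<and> \<zeta> \<in> hspace M D u})"

definition hmap ::
  "('a, 'e::euclidean_space) atlas \<Rightarrow> 'a connection \<Rightarrow> 'a tm \<Rightarrow> 'a tangent \<Rightarrow> 'a tm tangent" where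
  "hmap M D u = inv_into (hspace M D u) (rho M u)"

text \<open>The horizontal map \<open>\<beta>\<close>, the vertical lift \<open>\<gamma>\<close> and \<open>\<rho>\<close> on sections.\<close>

definition hlift_field ::
  "('a, 'e::euclidean_space) atlas \<Rightarrow> 'a connection \<Rightarrow> 'a pisection \<Rightarrow> 'a tfield" where
  "hlift_field M D X = (\<lambda>u. if u \<in> slit M then hmap M D u (X u) else 0)"

definition vlift_field :: "('a, 'e::euclidean_space) atlas \<Rightarrow> 'a pisection \<Rightarrow> 'a tfield" where
  "vlift_field M X = (\<lambda>u. if u \<in> slit M then vlift M u (X u) else 0)"

definition rho_field :: "('a, 'e::euclidean_space) atlas \<Rightarrow> 'a tfield \<Rightarrow> 'a pisection" where
  "rho_field M X = (\<lambda>u. if u \<in> slit M then rho M u (X u) else 0)"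

definition torsion ::
  "('a, 'e::euclidean_space) atlas \<Rightarrow> 'a connection \<Rightarrow> 'a tfield \<Rightarrow> 'a tfield \<Rightarrow> 'a pisection" where
  "torsion M D X Y =
     cov M D X (rho_field M Y) - cov M D Y (rho_field M X)
       - rho_field M (lie_bracket (slit_atlas M) X Y)"

definition cartan_connection ::
  "('a, 'e::euclidean_space) atlas \<Rightarrow> ('a tm \<Rightarrow> real) \<Rightarrow> 'a connection \<Rightarrow> bool" where
  "cartan_connection M L D \<longleftrightarrow> regular_connection M D \<and>
     \<comment> \<open>\<open>D g = 0\<close>\<close>
     (\<forall>Y Z. pi_field M Y \<longrightarrow> pi_field M Z \<longrightarrow> (\<forall>u\<in>slit M. \<forall>\<xi>\<in>ttm M u.
        \<xi> (\<lambda>w. fmetric L w (Y w) (Z w)) =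
          fmetric L u (D u \<xi> Y) (Z u) + fmetric L u (Y u) (D u \<xi> Z))) \<and>
     \<comment> \<open>the horizontal torsion \<open>Q\<close> vanishes\<close>
     (\<forall>X Y. pi_field M X \<longrightarrow> pi_field M Y \<longrightarrow> (\<forall>u\<in>slit M.
        torsion M D (hlift_field M D X) (hlift_field M D Y) u = 0)) \<and>
     \<comment> \<open>symmetry of the mixed torsion \<open>T\<close>\<close>
     (\<forall>X Y Z. pi_field M X \<longrightarrow> pi_field M Y \<longrightarrow> pi_field M Z \<longrightarrow> (\<forall>u\<in>slit M.
        fmetric L u (torsion M D (vlift_field M X) (hlift_field M D Y) u) (Z u) =
        fmetric L u (torsion M D (vlift_field M X) (hlift_field M D Z) u) (Y u)))"


section \<open>Curvature tensors\<close>

text \<open>The sign is opposite to the usual \<open>D\<^sub>X D\<^sub>Y - D\<^sub>Y D\<^sub>X - D\<^sub>[\<^sub>X\<^sub>,\<^sub>Y\<^sub>]\<close>; \<open>Ric\<close> and \<open>G_tensor\<close> below are adapted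
  to this convention.\<close>

definition curvature ::
  "('a, 'e::euclidean_space) atlas \<Rightarrow> 'a connection \<Rightarrow> 'a tfield \<Rightarrow> 'a tfield \<Rightarrow> 'a pisection \<Rightarrow> 'a pisection" where
  "curvature M D X Y Z =
     - cov M D X (cov M D Y Z) + cov M D Y (cov M D X Z) + cov M D (lie_bracket (slit_atlas M) X Y) Z"

text \<open>Tensor fields are given pointwise. The value of the horizontal curvature on vectors at \<open>u\<close> is
  obtained from arbitrary \<open>\<pi>\<close>-vector fields with these values at \<open>u\<close>; since the curvature is
  tensorial, the choice does not matter.\<close>

type_synonym 'a tensor13 = "'a tm \<Rightarrow> 'a tangent \<Rightarrow> 'a tangent \<Rightarrow> 'a tangent \<Rightarrow> 'a tangent"

definition extend :: "('a, 'e::euclidean_space) atlas \<Rightarrow> 'a tm \<Rightarrow> 'a tangent \<Rightarrow> 'a pisection" where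
  "extend M u x = (SOME X. pi_field M X \<and> X u = x)"

definition hcurv :: "('a, 'e::euclidean_space) atlas \<Rightarrow> 'a connection \<Rightarrow> 'a tensor13" where
  "hcurv M D u x y z =
     curvature M D (hlift_field M D (extend M u x)) (hlift_field M D (extend M u y)) (extend M u z) u"

text \<open>The trace of an endomorphism \<open>T\<close> of a finite-dimensional linear subspace \<open>V\<close>.\<close>

definition endo_trace :: "'v::real_vector set \<Rightarrow> ('v \<Rightarrow> 'v) \<Rightarrow> real" where
  "endo_trace V T = (let B = (SOME B. independent B \<and> span B = V)
     in \<Sum>b\<in>B. representation B (T b) b)"

definition Ric ::
  "('a, 'e::euclidean_space) atlas \<Rightarrow> 'a connection \<Rightarrow> 'a tm \<Rightarrow> 'a tangent \<Rightarrow> 'a tangent \<Rightarrow> real" where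
  "Ric M D u x y = endo_trace (fibre M u) (\<lambda>z. hcurv M D u x z y)"

definition Ric_op ::
  "('a, 'e::euclidean_space) atlas \<Rightarrow> ('a tm \<Rightarrow> real) \<Rightarrow> 'a connection \<Rightarrow> 'a tm \<Rightarrow> 'a tangent \<Rightarrow> 'a tangent" where
  "Ric_op M L D u x =
     (THE z. z \<in> fibre M u \<and> (\<forall>y\<in>fibre M u. fmetric L u z y = Ric M D u x y))"

definition hscalar ::
  "('a, 'e::euclidean_space) atlas \<Rightarrow> ('a tm \<Rightarrow> real) \<Rightarrow> 'a connection \<Rightarrow> 'a tm \<Rightarrow> real" where
  "hscalar M L D u = endo_trace (fibre M u) (Ric_op M L D u)"

definition G_tensor :: "('a tm \<Rightarrow> real) \<Rightarrow> 'a tensor13" where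
  "G_tensor L u x y z = fmetric L u x z *\<^sub>R y - fmetric L u y z *\<^sub>R x"

definition concircular ::
  "('a, 'e::euclidean_space) atlas \<Rightarrow> ('a tm \<Rightarrow> real) \<Rightarrow> 'a connection \<Rightarrow> 'a tensor13" where
  "concircular M L D u x y z = hcurv M D u x y z
     - (hscalar M L D u / (real DIM('e) * (real DIM('e) - 1))) *\<^sub>R G_tensor L u x y z"

definition projective :: "('a, 'e::euclidean_space) atlas \<Rightarrow> 'a connection \<Rightarrow> 'a tensor13" where
  "projective M D u x y z = hcurv M D u x y z
     - (1 / (real DIM('e) - 1)) *\<^sub>R (Ric M D u x z *\<^sub>R y - Ric M D u y z *\<^sub>R x)"

definition m_projective ::
  "('a, 'e::euclidean_space) atlas \<Rightarrow> ('a tm \<Rightarrow> real) \<Rightarrow> 'a connection \<Rightarrow> 'a tensor13" where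
  "m_projective M L D u x y z = hcurv M D u x y z
     - (1 / (2 * (real DIM('e) - 1))) *\<^sub>R
         (Ric M D u x z *\<^sub>R y - Ric M D u y z *\<^sub>R x
          + fmetric L u x z *\<^sub>R Ric_op M L D u y - fmetric L u y z *\<^sub>R Ric_op M L D u x)"


section \<open>Recurrence\<close>

definition tensor_app ::
  "('a, 'e::euclidean_space) atlas \<Rightarrow> 'a tensor13 \<Rightarrow> 'a pisection \<Rightarrow> 'a pisection \<Rightarrow> 'a pisection \<Rightarrow> 'a pisection" where
  "tensor_app M B X Y Z = (\<lambda>u. if u \<in> slit M then B u (X u) (Y u) (Z u) else 0)"

definition hcov ::
  "('a, 'e::euclidean_space) atlas \<Rightarrow> 'a connection \<Rightarrow> 'a tensor13 \<Rightarrow>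
     'a pisection \<Rightarrow> 'a pisection \<Rightarrow> 'a pisection \<Rightarrow> 'a pisection \<Rightarrow> 'a pisection" where
  "hcov M D B W X Y Z =
     cov M D (hlift_field M D W) (tensor_app M B X Y Z)
     - tensor_app M B (cov M D (hlift_field M D W) X) Y Z
     - tensor_app M B X (cov M D (hlift_field M D W) Y) Z
     - tensor_app M B X Y (cov M D (hlift_field M D W) Z)"

definition recurrent ::
  "('a, 'e::euclidean_space) atlas \<Rightarrow> 'a connection \<Rightarrow> 'a tensor13 \<Rightarrow> bool" where
  "recurrent M D B \<longleftrightarrow> (\<exists>A. pi_form M A \<and> (\<exists>u\<in>slit M. \<exists>x\<in>fibre M u. A u x \<noteq> 0) \<and>
     (\<forall>W X Y Z. pi_field M W \<longrightarrow> pi_field M X \<longrightarrow> pi_field M Y \<longrightarrow> pi_field M Z \<longrightarrow>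
        (\<forall>u\<in>slit M. hcov M D B W X Y Z u = A u (W u) *\<^sub>R B u (X u) (Y u) (Z u))))"

definition concircularly_recurrent ::
  "('a, 'e::euclidean_space) atlas \<Rightarrow> ('a tm \<Rightarrow> real) \<Rightarrow> 'a connection \<Rightarrow> bool" where
  "concircularly_recurrent M L D \<longleftrightarrow> recurrent M D (concircular M L D)"

definition projectively_recurrent :: "('a, 'e::euclidean_space) atlas \<Rightarrow> 'a connection \<Rightarrow> bool" where
  "projectively_recurrent M D \<longleftrightarrow> recurrent M D (projective M D)"

definition m_projectively_recurrent ::
  "('a, 'e::euclidean_space) atlas \<Rightarrow> ('a tm \<Rightarrow> real) \<Rightarrow> 'a connection \<Rightarrow> bool" where
  "m_projectively_recurrent M L D \<longleftrightarrow> recurrent M D (m_projective M L D)"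

end

theory Submission
  imports Defs
begin

text \<open>Under the Einstein condition \<open>Ric = (r/n) g\<close> the three curvature tensors coincide: substituting
  it in the projective tensor \<open>\<bbbP>\<close> turns the correction term into \<open>r/(n(n-1)) G\<close>, which is that of
  the concircular tensor \<open>C\<close>; and since \<open>g\<close> is nondegenerate, the condition says that
  \<open>Ric\<^sub>o = (r/n) id\<close>, so that the two halves of the correction term of the m-projective tensor
  \<open>\<bbbH>\<close> are equal and add up to that of \<open>\<bbbP>\<close>. Equal tensors are recurrent with the same
  recurrence form.

  The coincidence is only available on vectors of the fibres, tangent to \<open>M\<close>, and the work
  lies in the two places where this matters.

  To get \<open>Ric\<^sub>o\<close> (\<open>Ric_op_einstein\<close>), the metric must be linear in its first argument.
  It is defined by iterated one-variable derivatives of \<open>L\<^sup>2\<close> along a fibre, and \<open>fmetric_in_chart\<close>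
  identifies it with a second Frechet derivative in a chart.

  To transfer recurrence (\<open>recurrent_cong\<close>), the covariant derivatives \<open>\<nabla>\<^bsub>\<beta>W\<^esub> X\<close>, which are arguments
  of the tensor in its own covariant derivative, must again lie in the fibres. This is known for
  derivatives along vectors tangent to the slit tangent bundle, and \<open>\<beta>W\<close> is such a vector
  because \<open>\<rho>\<close> maps the horizontal space onto the fibre: \<open>\<rho>\<close> is onto by a computation in charts
  (\<open>rho_surj\<close>), and the vertical space is its kernel.

  Both rest on the description of tangent vectors by their coordinates in an arbitrary chart
  (\<open>chart_vector_coords\<close>), which also shows that the charts of the slit tangent bundle are injective
  with open images.\<close>


section \<open>Calculus of \<open>C\<^sup>k\<close> maps\<close>

lemma frechet_derivative_eqI: "(f has_derivative f') (at x) \<Longrightarrow> frechet_derivative f (at x) = f'"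
  using frechet_derivative_at by metis

lemma Ck_on_cong:
  assumes "open S" "\<And>x. x \<in> S \<Longrightarrow> f x = g x" "Ck_on k S f"
  shows "Ck_on k S g"
  using assms(2,3)
proof (induction k arbitrary: f g)
  case 0
  then show ?case by (simp cong: continuous_on_cong)
next
  case (Suc k)
  have der: "(g has_derivative frechet_derivative f (at x)) (at x)" if "x \<in> S" for x
    using Suc.prems that assms(1)
    by (intro has_derivative_transform_within_open[of f _ x UNIV S g])
       (auto simp flip: frechet_derivative_works)
  have "Ck_on k S (\<lambda>x. frechet_derivative g (at x) v)" for v
  proof (rule Suc.IH)
    show "Ck_on k S (\<lambda>x. frechet_derivative f (at x) v)"
      using Suc.prems(2) by simp
    show "frechet_derivative f (at x) v = frechet_derivative g (at x) v" if "x \<in> S" for x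
      using frechet_derivative_eqI[OF der[OF that]] by simp
  qed
  with der show ?case by (auto simp: differentiable_def)
qed

lemma Ck_on_bounded_linear:
  assumes "open S" "bounded_linear A" "Ck_on k S f"
  shows "Ck_on k S (\<lambda>x. A (f x))"
  using assms(3)
proof (induction k arbitrary: f)
  case 0
  then show ?case
    using linear_continuous_on_compose bounded_linear.continuous_on[OF assms(2)] by auto
next
  case (Suc k)
  have der: "((\<lambda>x. A (f x)) has_derivative (\<lambda>v. A (frechet_derivative f (at x) v))) (at x)"
    if "x \<in> S" for x
    using Suc.prems that
    by (intro bounded_linear.has_derivative[OF assms(2)]) (auto simp flip: frechet_derivative_works)
  have "Ck_on k S (\<lambda>x. frechet_derivative (\<lambda>x. A (f x)) (at x) v)" for v
  proof (rule Ck_on_cong[OF assms(1)])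
    show "Ck_on k S (\<lambda>x. A (frechet_derivative f (at x) v))"
      using Suc by simp
  qed (simp add: frechet_derivative_eqI[OF der])
  with der show ?case by (auto simp: differentiable_def)
qed

lemma Ck_on_fst:
  assumes "open S" "open T" "Ck_on k S f"
  shows "Ck_on k (S \<times> T) (\<lambda>x. f (fst x))"
  using assms(3)
proof (induction k arbitrary: f)
  case 0
  then show ?case
    by (auto intro!: continuous_intros continuous_on_compose2[of S f])
next
  case (Suc k)
  have der: "((\<lambda>x. f (fst x)) has_derivative (\<lambda>v. frechet_derivative f (at (fst x)) (fst v))) (at x)"
    if "x \<in> S \<times> T" for x
    using Suc.prems that
    by (intro has_derivative_compose[of fst fst x UNIV f]) (auto intro!: derivative_eq_intros simp flip: frechet_derivative_works)
  have "Ck_on k (S \<times> T) (\<lambda>x. frechet_derivative (\<lambda>x. f (fst x)) (at x) v)" for v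
  proof (rule Ck_on_cong[OF open_Times[OF assms(1,2)]])
    show "Ck_on k (S \<times> T) (\<lambda>x. frechet_derivative f (at (fst x)) (fst v))"
      using Suc.IH[of "\<lambda>x. frechet_derivative f (at x) (fst v)"] Suc.prems by simp
  qed (simp add: frechet_derivative_eqI[OF der])
  with der show ?case by (auto simp: differentiable_def)
qed

lemma smooth_on_differentiable:
  assumes "smooth_on S f" "x \<in> S"
  shows "f differentiable (at x)"
  using assms by (auto simp: smooth_on_def dest!: spec[of _ "Suc 0"])

lemma smooth_on_twice_differentiable:
  assumes "smooth_on S f" "x \<in> S"
  shows "(\<lambda>z. frechet_derivative f (at z) v) differentiable (at x)"
proof -
  have "Ck_on (Suc (Suc 0)) S f" using assms(1) by (simp only: smooth_on_def)
  then show ?thesis using assms(2) by simp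
qed


section \<open>Topology and tangent vectors in a chart\<close>

text \<open>Injectivity of the charts is what makes the family of sets with open chart images closed
  under intersection.\<close>

lemma openin_mtop:
  assumes "\<And>U \<phi>. (U, \<phi>) \<in> M \<Longrightarrow> inj_on \<phi> U"
  shows "openin (mtop M) W \<longleftrightarrow> W \<subseteq> carrier M \<and> (\<forall>(U, \<phi>)\<in>M. open (\<phi> ` (U \<inter> W)))"
proof -
  have int: "open (\<phi> ` (U \<inter> (A \<inter> B)))"
    if "(U, \<phi>) \<in> M" "open (\<phi> ` (U \<inter> A))" "open (\<phi> ` (U \<inter> B))" for U \<phi> A B
  proof -
    have "\<phi> ` (U \<inter> (A \<inter> B)) = \<phi> ` (U \<inter> A) \<inter> \<phi> ` (U \<inter> B)"
      using assms[OF that(1)] by (auto simp: inj_on_def)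
    with that show ?thesis by auto
  qed
  have un: "open (\<phi> ` (U \<inter> \<Union>\<K>))" if "\<And>A. A \<in> \<K> \<Longrightarrow> open (\<phi> ` (U \<inter> A))" for U \<K>
    and \<phi> :: "'a \<Rightarrow> 'b"
  proof -
    have "\<phi> ` (U \<inter> \<Union>\<K>) = (\<Union>A\<in>\<K>. \<phi> ` (U \<inter> A))" by auto
    with that show ?thesis by auto
  qed
  have "istopology (\<lambda>W. W \<subseteq> carrier M \<and> (\<forall>(U, \<phi>)\<in>M. open (\<phi> ` (U \<inter> W))))"
    unfolding istopology_def
  proof (intro conjI allI impI)
    fix \<K>
    assume "\<forall>K\<in>\<K>. K \<subseteq> carrier M \<and> (\<forall>(U, \<phi>)\<in>M. open (\<phi> ` (U \<inter> K)))"
    then show "\<Union>\<K> \<subseteq> carrier M" and "\<forall>(U, \<phi>)\<in>M. open (\<phi> ` (U \<inter> \<Union>\<K>))"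
      by (blast, auto intro!: un)
  next
    fix A B
    assume "A \<subseteq> carrier M \<and> (\<forall>(U, \<phi>)\<in>M. open (\<phi> ` (U \<inter> A)))"
      and "B \<subseteq> carrier M \<and> (\<forall>(U, \<phi>)\<in>M. open (\<phi> ` (U \<inter> B)))"
    then show "A \<inter> B \<subseteq> carrier M" and "\<forall>(U, \<phi>)\<in>M. open (\<phi> ` (U \<inter> (A \<inter> B)))"
      using int by blast+
  qed
  then show ?thesis by (simp add: mtop_def topology_inverse')
qed

lemma inj_on_chart: "smooth_manifold M \<Longrightarrow> (U, \<phi>) \<in> M \<Longrightarrow> inj_on \<phi> U"
  by (auto simp: smooth_manifold_def)

lemma openin_mtop_manifold:
  "smooth_manifold M \<Longrightarrow>
    openin (mtop M) W \<longleftrightarrow> W \<subseteq> carrier M \<and> (\<forall>(U, \<phi>)\<in>M. open (\<phi> ` (U \<inter> W)))"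
  by (rule openin_mtop) (rule inj_on_chart)

lemma transition_map:
  assumes "smooth_manifold M" "(U, \<phi>) \<in> M" "(V, \<psi>) \<in> M"
  shows "open (\<phi> ` (U \<inter> V))" "smooth_on (\<phi> ` (U \<inter> V)) (\<psi> \<circ> inv_into U \<phi>)"
  using assms unfolding smooth_manifold_def by blast+

lemma open_chart_image: "smooth_manifold M \<Longrightarrow> (U, \<phi>) \<in> M \<Longrightarrow> open (\<phi> ` U)"
  using transition_map(1)[of M U \<phi> U \<phi>] by simp

lemma openin_chart_domain:
  assumes "smooth_manifold M" "(U, \<phi>) \<in> M"
  shows "openin (mtop M) U"
proof -
  have "U \<subseteq> carrier M" using assms(2) by (auto simp: carrier_def)
  moreover have "\<forall>(V, \<psi>)\<in>M. open (\<psi> ` (V \<inter> U))"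
    using transition_map(1)[OF assms(1) _ assms(2)] by blast
  ultimately show ?thesis
    unfolding openin_mtop_manifold[OF assms(1)] by blast
qed

lemma smooth_atE:
  assumes "smooth_manifold M" "smooth_at M f p"
  obtains W where "p \<in> W" "W \<subseteq> carrier M" "\<And>U \<phi>. (U, \<phi>) \<in> M \<Longrightarrow> open (\<phi> ` (U \<inter> W))"
    "\<And>U \<phi>. (U, \<phi>) \<in> M \<Longrightarrow> smooth_on (\<phi> ` (U \<inter> W)) (f \<circ> inv_into U \<phi>)"
proof -
  obtain W where W: "openin (mtop M) W" "p \<in> W" "smooth_fun_on M W f"
    using assms(2) unfolding smooth_at_def by blast
  show ?thesis
  proof (rule that)
    show "p \<in> W" "W \<subseteq> carrier M"
      using W openin_mtop_manifold[OF assms(1)] by auto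
    fix U \<phi> assume "(U, \<phi>) \<in> M"
    then show "open (\<phi> ` (U \<inter> W))" "smooth_on (\<phi> ` (U \<inter> W)) (f \<circ> inv_into U \<phi>)"
      using W(1,3) unfolding openin_mtop_manifold[OF assms(1)] smooth_fun_on_def by fast+
  qed
qed

lemma smooth_at_differentiable:
  assumes "smooth_manifold M" "(U, \<phi>) \<in> M" "p \<in> U" "smooth_at M f p"
  shows "(f \<circ> inv_into U \<phi>) differentiable (at (\<phi> p))"
proof -
  obtain W where "p \<in> W" "smooth_on (\<phi> ` (U \<inter> W)) (f \<circ> inv_into U \<phi>)"
    using smooth_atE[OF assms(1,4)] assms(2) by metis
  then show ?thesis using assms(3) by (intro smooth_on_differentiable) auto
qed

lemma smooth_at_coordinate:
  assumes "smooth_manifold M" "(U, \<phi>) \<in> M" "p \<in> U"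
  shows "smooth_at M (\<lambda>q. \<phi> q \<bullet> b) p"
proof -
  have "smooth_on (\<psi> ` (V \<inter> U)) ((\<lambda>q. \<phi> q \<bullet> b) \<circ> inv_into V \<psi>)" if "(V, \<psi>) \<in> M" for V \<psi>
    unfolding smooth_on_def
  proof
    fix k
    have "Ck_on k (\<psi> ` (V \<inter> U)) (\<phi> \<circ> inv_into V \<psi>)"
      using transition_map(2)[OF assms(1) that assms(2)] by (simp add: smooth_on_def)
    from Ck_on_bounded_linear[OF transition_map(1)[OF assms(1) that assms(2)]
        bounded_linear_inner_left this]
    show "Ck_on k (\<psi> ` (V \<inter> U)) ((\<lambda>q. \<phi> q \<bullet> b) \<circ> inv_into V \<psi>)"
      by (simp only: comp_def)
  qed
  then show ?thesis
    using openin_chart_domain[OF assms(1,2)] assms(3)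
    unfolding smooth_at_def smooth_fun_on_def by blast
qed

definition chart_vector ::
  "('a, 'e::euclidean_space) atlas \<Rightarrow> 'a set \<Rightarrow> ('a \<Rightarrow> 'e) \<Rightarrow> 'a \<Rightarrow> 'e \<Rightarrow> 'a tangent" where
  "chart_vector M U \<phi> p w =
     (\<lambda>f. if smooth_at M f p then frechet_derivative (f \<circ> inv_into U \<phi>) (at (\<phi> p)) w else 0)"

definition coords :: "('a \<Rightarrow> 'e::euclidean_space) \<Rightarrow> 'a tangent \<Rightarrow> 'e" where
  "coords \<phi> v = (\<Sum>b\<in>Basis. v (\<lambda>q. \<phi> q \<bullet> b) *\<^sub>R b)"

lemma coords_linear:
  "coords \<phi> (x + y) = coords \<phi> x + coords \<phi> y" "coords \<phi> (c *\<^sub>R x) = c *\<^sub>R coords \<phi> x"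
  by (simp add: coords_def scaleR_add_left sum.distrib)
    (simp add: coords_def scaleR_fun_def scaleR_sum_right)

lemma coords_0: "coords \<phi> 0 = 0"
  by (simp add: coords_def)

lemma tangent_space_chart_vector:
  "tangent_space M p = {chart_vector M U \<phi> p w | U \<phi> w. (U, \<phi>) \<in> M \<and> p \<in> U}"
  by (auto simp: tangent_space_def chart_vector_def)

lemma chart_vector_in_tangent_space:
  "(U, \<phi>) \<in> M \<Longrightarrow> p \<in> U \<Longrightarrow> chart_vector M U \<phi> p w \<in> tangent_space M p"
  by (auto simp: tangent_space_chart_vector)

lemma chart_vector_linear:
  assumes "smooth_manifold M" "(U, \<phi>) \<in> M" "p \<in> U"
  shows "chart_vector M U \<phi> p (w + w') = chart_vector M U \<phi> p w + chart_vector M U \<phi> p w'"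
    and "chart_vector M U \<phi> p (c *\<^sub>R w) = c *\<^sub>R chart_vector M U \<phi> p w"
proof -
  have "frechet_derivative (f \<circ> inv_into U \<phi>) (at (\<phi> p)) (w + w')
      = frechet_derivative (f \<circ> inv_into U \<phi>) (at (\<phi> p)) w
        + frechet_derivative (f \<circ> inv_into U \<phi>) (at (\<phi> p)) w'"
    and "frechet_derivative (f \<circ> inv_into U \<phi>) (at (\<phi> p)) (c *\<^sub>R w)
      = c * frechet_derivative (f \<circ> inv_into U \<phi>) (at (\<phi> p)) w" if "smooth_at M f p" for f
    using linear_frechet_derivative[OF smooth_at_differentiable[OF assms that]]
    by (simp_all only: linear_add linear_scale real_scaleR_def)
  then show "chart_vector M U \<phi> p (w + w') = chart_vector M U \<phi> p w + chart_vector M U \<phi> p w'"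
    and "chart_vector M U \<phi> p (c *\<^sub>R w) = c *\<^sub>R chart_vector M U \<phi> p w"
    by (auto simp: chart_vector_def fun_eq_iff scaleR_fun_def)
qed

lemma coords_chart_vector:
  assumes "smooth_manifold M" "(U, \<phi>) \<in> M" "p \<in> U"
  shows "coords \<phi> (chart_vector M U \<phi> p w) = w"
proof -
  have "chart_vector M U \<phi> p w (\<lambda>q. \<phi> q \<bullet> b) = w \<bullet> b" for b
  proof -
    have "((\<lambda>z. z \<bullet> b) has_derivative (\<lambda>w. w \<bullet> b)) (at (\<phi> p))"
      by (intro bounded_linear_imp_has_derivative bounded_linear_inner_left)
    then have der: "((\<lambda>q. \<phi> q \<bullet> b) \<circ> inv_into U \<phi> has_derivative (\<lambda>w. w \<bullet> b)) (at (\<phi> p))"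
      by (rule has_derivative_transform_within_open[OF _ open_chart_image[OF assms(1,2)]])
         (simp_all add: assms(3) f_inv_into_f)
    show ?thesis
      using smooth_at_coordinate[OF assms] by (simp add: chart_vector_def frechet_derivative_eqI[OF der])
  qed
  then show ?thesis by (simp add: coords_def euclidean_representation)
qed

text \<open>The chain rule for the transition map: a tangent vector given in one chart is a chart vector
  of every other chart around the point.\<close>

lemma chart_vector_coords:
  assumes "smooth_manifold M" "(U, \<phi>) \<in> M" "p \<in> U" "v \<in> tangent_space M p"
  shows "chart_vector M U \<phi> p (coords \<phi> v) = v"
proof -
  obtain V \<psi> w where V: "(V, \<psi>) \<in> M" "p \<in> V" and v: "v = chart_vector M V \<psi> p w"
    using assms(4) by (auto simp: tangent_space_chart_vector)
  define w' where "w' = frechet_derivative (\<phi> \<circ> inv_into V \<psi>) (at (\<psi> p)) w"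
  have inj: "inj_on \<psi> V" "inj_on \<phi> U" using inj_on_chart[OF assms(1)] V assms(2) by auto
  have "frechet_derivative (f \<circ> inv_into V \<psi>) (at (\<psi> p)) w
      = frechet_derivative (f \<circ> inv_into U \<phi>) (at (\<phi> p)) w'" if f: "smooth_at M f p" for f
  proof -
    let ?t = "\<phi> \<circ> inv_into V \<psi>" and ?f = "f \<circ> inv_into U \<phi>"
    have "?t differentiable (at (\<psi> p))"
      using transition_map(2)[OF assms(1) V(1) assms(2)] V(2) assms(3)
      by (blast intro: smooth_on_differentiable)
    then have t: "(?t has_derivative frechet_derivative ?t (at (\<psi> p))) (at (\<psi> p))"
      by (simp flip: frechet_derivative_works)
    have tp: "?t (\<psi> p) = \<phi> p" using inj V(2) by simp
    have "(?f has_derivative frechet_derivative ?f (at (\<phi> p))) (at (\<phi> p))"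
      using smooth_at_differentiable[OF assms(1-3) f] by (simp flip: frechet_derivative_works)
    with t have "(?f \<circ> ?t has_derivative
        frechet_derivative ?f (at (\<phi> p)) \<circ> frechet_derivative ?t (at (\<psi> p))) (at (\<psi> p))"
      by (intro diff_chain_at) (simp_all only: tp)
    then have "(f \<circ> inv_into V \<psi> has_derivative
        frechet_derivative ?f (at (\<phi> p)) \<circ> frechet_derivative ?t (at (\<psi> p))) (at (\<psi> p))"
    proof (rule has_derivative_transform_within_open)
      show "open (\<psi> ` (V \<inter> U))" by (rule transition_map(1)[OF assms(1) V(1) assms(2)])
      show "\<psi> p \<in> \<psi> ` (V \<inter> U)" using V(2) assms(3) by blast
      show "(?f \<circ> ?t) z = (f \<circ> inv_into V \<psi>) z" if "z \<in> \<psi> ` (V \<inter> U)" for z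
        using that inj by (auto simp: inv_into_f_f)
    qed
    from frechet_derivative_eqI[OF this] show ?thesis by (simp add: w'_def)
  qed
  then have "v = chart_vector M U \<phi> p w'"
    by (auto simp: v chart_vector_def)
  then show ?thesis using coords_chart_vector[OF assms(1-3)] by simp
qed

lemma tangent_space_closed:
  assumes "smooth_manifold M" "x \<in> tangent_space M p" "y \<in> tangent_space M p"
  shows "x + y \<in> tangent_space M p" "c *\<^sub>R x \<in> tangent_space M p"
proof -
  obtain U \<phi> where U: "(U, \<phi>) \<in> M" "p \<in> U"
    using assms(2) by (auto simp: tangent_space_chart_vector)
  note [simp] = chart_vector_coords[OF assms(1) U]
  have "x + y = chart_vector M U \<phi> p (coords \<phi> x + coords \<phi> y)"
    "c *\<^sub>R x = chart_vector M U \<phi> p (c *\<^sub>R coords \<phi> x)"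
    using assms(2,3) by (simp_all add: chart_vector_linear[OF assms(1) U])
  then show "x + y \<in> tangent_space M p" "c *\<^sub>R x \<in> tangent_space M p"
    using chart_vector_in_tangent_space[OF U] by auto
qed


section \<open>Charts of the slit tangent bundle\<close>

abbreviation slit_over :: "('a, 'e::euclidean_space) atlas \<Rightarrow> 'a set \<Rightarrow> 'a tm set" where
  "slit_over M W \<equiv> {u\<in>slit M. fst u \<in> W}"

definition slit_chart :: "('a \<Rightarrow> 'e::euclidean_space) \<Rightarrow> 'a tm \<Rightarrow> 'e \<times> 'e" where
  "slit_chart \<phi> u = (\<phi> (fst u), coords \<phi> (snd u))"

lemma slit_atlas_eq: "slit_atlas M = (\<lambda>(U, \<phi>). (slit_over M U, slit_chart \<phi>)) ` M"
  unfolding slit_atlas_def slit_chart_def coords_def by (simp add: case_prod_unfold)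

lemma slit_chart_mem: "(U, \<phi>) \<in> M \<Longrightarrow> (slit_over M U, slit_chart \<phi>) \<in> slit_atlas M"
  by (force simp: slit_atlas_eq)

lemma coords_eq_0_iff:
  assumes "smooth_manifold M" "(U, \<phi>) \<in> M" "p \<in> U" "v \<in> tangent_space M p"
  shows "coords \<phi> v = 0 \<longleftrightarrow> v = 0"
proof
  assume "coords \<phi> v = 0"
  then show "v = 0"
    using chart_vector_coords[OF assms] chart_vector_linear(2)[OF assms(1-3), of 0 0] by simp
qed (simp add: coords_def)

lemma inj_on_slit_chart:
  assumes "smooth_manifold M" "(U, \<phi>) \<in> M"
  shows "inj_on (slit_chart \<phi>) (slit_over M U)"
proof (rule inj_onI)
  fix u u' assume u: "u \<in> slit_over M U" "u' \<in> slit_over M U"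
    and eq: "slit_chart \<phi> u = slit_chart \<phi> u'"
  then have p: "fst u = fst u'"
    using inj_on_chart[OF assms] by (auto simp: slit_chart_def inj_on_def)
  have "snd u \<in> tangent_space M (fst u)" "snd u' \<in> tangent_space M (fst u)"
    using u p by (auto simp: slit_def)
  then have "snd u = snd u'"
    using chart_vector_coords[OF assms, of "fst u"] eq u by (metis (no_types, lifting) mem_Collect_eq prod.inject slit_chart_def)
  with p show "u = u'" by (simp add: prod_eq_iff)
qed

lemma slit_expression_fst:
  assumes "smooth_manifold M" "(U, \<phi>) \<in> M" "z \<in> slit_chart \<phi> ` slit_over M U"
  shows "((f \<circ> fst) \<circ> inv_into (slit_over M U) (slit_chart \<phi>)) z = (f \<circ> inv_into U \<phi>) (fst z)"
proof -
  obtain u where u: "u \<in> slit_over M U" and z: "z = slit_chart \<phi> u" using assms(3) by blast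
  have "inv_into (slit_over M U) (slit_chart \<phi>) z = u"
    unfolding z by (rule inv_into_f_f[OF inj_on_slit_chart[OF assms(1,2)] u])
  moreover have "inv_into U \<phi> (fst z) = fst u"
    using u inj_on_chart[OF assms(1,2)] by (simp add: z slit_chart_def inv_into_f_f)
  ultimately show ?thesis by simp
qed

lemma slit_chart_image:
  fixes M :: "('a, 'e::euclidean_space) atlas"
  assumes "smooth_manifold M" "(U, \<phi>) \<in> M" "W \<subseteq> U"
  shows "slit_chart \<phi> ` slit_over M W = (\<phi> ` W) \<times> (- {0})"
proof (intro equalityI subsetI)
  fix z assume "z \<in> slit_chart \<phi> ` slit_over M W"
  then show "z \<in> (\<phi> ` W) \<times> (- {0})"
    using coords_eq_0_iff[OF assms(1,2)] assms(3) by (auto simp: slit_chart_def slit_def)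
next
  fix z :: "'e \<times> 'e" assume "z \<in> (\<phi> ` W) \<times> (- {0})"
  then obtain p w where z: "z = (\<phi> p, w)" and p: "p \<in> W" and w: "w \<noteq> 0" by auto
  have pU: "p \<in> U" using p assms(3) by blast
  let ?v = "chart_vector M U \<phi> p w"
  have c: "coords \<phi> ?v = w" by (rule coords_chart_vector[OF assms(1,2) pU])
  have "?v \<noteq> 0" using c w by (auto simp: coords_def)
  then have "(p, ?v) \<in> slit_over M W"
    using chart_vector_in_tangent_space[OF assms(2) pU] p pU assms(2)
    by (auto simp: slit_def carrier_def)
  then show "z \<in> slit_chart \<phi> ` slit_over M W"
    using c z by (force simp: slit_chart_def)
qed

lemma carrier_slit_atlas: "carrier (slit_atlas M) = slit M"
proof -
  have "carrier (slit_atlas M) = (\<Union>(U, \<phi>)\<in>M. slit_over M U)"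
    by (simp add: carrier_def slit_atlas_eq case_prod_unfold)
  also have "\<dots> = {u\<in>slit M. fst u \<in> carrier M}"
    unfolding carrier_def by blast
  also have "\<dots> = slit M" by (auto simp: slit_def)
  finally show ?thesis .
qed

lemma openin_mtop_slit:
  assumes "smooth_manifold M"
  shows "openin (mtop (slit_atlas M)) W \<longleftrightarrow>
    W \<subseteq> carrier (slit_atlas M) \<and> (\<forall>(U, \<phi>)\<in>slit_atlas M. open (\<phi> ` (U \<inter> W)))"
  by (rule openin_mtop) (auto simp: slit_atlas_eq inj_on_slit_chart[OF assms])

text \<open>In a chart, \<open>f \<circ> fst\<close> is the coordinate expression of \<open>f\<close> composed with the projection
  to the base coordinates, hence smooth.\<close>

lemma smooth_at_slit_fst:
  assumes "smooth_manifold M" "u \<in> slit M" "smooth_at M f (fst u)"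
  shows "smooth_at (slit_atlas M) (f \<circ> fst) u"
proof -
  obtain W where W: "fst u \<in> W" "W \<subseteq> carrier M"
    and o: "\<And>U \<phi>. (U, \<phi>) \<in> M \<Longrightarrow> open (\<phi> ` (U \<inter> W))"
    and s: "\<And>U \<phi>. (U, \<phi>) \<in> M \<Longrightarrow> smooth_on (\<phi> ` (U \<inter> W)) (f \<circ> inv_into U \<phi>)"
    using smooth_atE[OF assms(1,3)] by metis
  have img: "slit_chart \<phi> ` (slit_over M U \<inter> slit_over M W) = \<phi> ` (U \<inter> W) \<times> (- {0})"
    if "(U, \<phi>) \<in> M" for U \<phi>
  proof -
    have "slit_over M U \<inter> slit_over M W = slit_over M (U \<inter> W)" by auto
    then show ?thesis using slit_chart_image[OF assms(1) that, of "U \<inter> W"] by simp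
  qed
  have sub: "slit_over M W \<subseteq> carrier (slit_atlas M)"
    by (auto simp: carrier_slit_atlas)
  have opn: "openin (mtop (slit_atlas M)) (slit_over M W)"
    unfolding openin_mtop_slit[OF assms(1)]
    using sub img o by (fastforce simp: slit_atlas_eq intro: open_Times open_Compl[OF closed_singleton])
  have "smooth_on (slit_chart \<phi> ` (slit_over M U \<inter> slit_over M W))
      ((f \<circ> fst) \<circ> inv_into (slit_over M U) (slit_chart \<phi>))" if U: "(U, \<phi>) \<in> M" for U \<phi>
    unfolding smooth_on_def
  proof
    fix k
    show "Ck_on k (slit_chart \<phi> ` (slit_over M U \<inter> slit_over M W))
      ((f \<circ> fst) \<circ> inv_into (slit_over M U) (slit_chart \<phi>))"
    proof (rule Ck_on_cong)
      show "Ck_on k (slit_chart \<phi> ` (slit_over M U \<inter> slit_over M W))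
          (\<lambda>z. (f \<circ> inv_into U \<phi>) (fst z))"
        unfolding img[OF U]
        by (rule Ck_on_fst[OF o[OF U] open_Compl[OF closed_singleton]])
           (use s[OF U] in \<open>simp add: smooth_on_def comp_def\<close>)
      show "open (slit_chart \<phi> ` (slit_over M U \<inter> slit_over M W))"
        unfolding img[OF U] by (intro open_Times o[OF U] open_Compl closed_singleton)
    qed (intro slit_expression_fst[OF assms(1) U, symmetric], blast)
  qed
  then have "smooth_fun_on (slit_atlas M) (slit_over M W) (f \<circ> fst)"
    unfolding smooth_fun_on_def by (auto simp: slit_atlas_eq)
  with opn show ?thesis
    using W(1) assms(2) unfolding smooth_at_def by blast
qed


section \<open>Horizontal lifts\<close>

text \<open>A vector with coordinates \<open>w\<close> is the image under \<open>\<rho>\<close> of the vector with coordinates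
  \<open>(w, 0)\<close>.\<close>

lemma rho_surj:
  assumes "smooth_manifold M" "u \<in> slit M" "x \<in> fibre M u"
  shows "\<exists>\<xi>\<in>ttm M u. rho M u \<xi> = x"
proof -
  obtain U \<phi> w where U: "(U, \<phi>) \<in> M" "fst u \<in> U" and x: "x = chart_vector M U \<phi> (fst u) w"
    using assms(3) by (auto simp: tangent_space_chart_vector)
  let ?U = "slit_over M U" and ?\<phi> = "slit_chart \<phi>"
  have u: "u \<in> ?U" using U assms(2) by simp
  let ?\<xi> = "chart_vector (slit_atlas M) ?U ?\<phi> u (w, 0)"
  have "rho M u ?\<xi> f = x f" for f
  proof (cases "smooth_at M f (fst u)")
    case f: True
    let ?f = "f \<circ> inv_into U \<phi>"
    have img: "?\<phi> ` ?U = \<phi> ` U \<times> (- {0})" using slit_chart_image[OF assms(1) U(1)] by simp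
    have "(?f has_derivative frechet_derivative ?f (at (\<phi> (fst u)))) (at (\<phi> (fst u)))"
      using smooth_at_differentiable[OF assms(1) U f] by (simp flip: frechet_derivative_works)
    then have "((\<lambda>z. ?f (fst z)) has_derivative
        (\<lambda>v. frechet_derivative ?f (at (\<phi> (fst u))) (fst v))) (at (?\<phi> u))"
      by (intro has_derivative_compose[of fst fst _ UNIV ?f])
         (auto intro!: derivative_eq_intros simp: slit_chart_def comp_def)
    then have der: "((f \<circ> fst) \<circ> inv_into ?U ?\<phi> has_derivative
        (\<lambda>v. frechet_derivative ?f (at (\<phi> (fst u))) (fst v))) (at (?\<phi> u))"
    proof (rule has_derivative_transform_within_open)
      show "open (?\<phi> ` ?U)" unfolding img using open_chart_image[OF assms(1) U(1)]
        by (auto intro!: open_Times)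
      show "?\<phi> u \<in> ?\<phi> ` ?U" using u by blast
      show "?f (fst z) = ((f \<circ> fst) \<circ> inv_into ?U ?\<phi>) z" if "z \<in> ?\<phi> ` ?U" for z
        using that by (rule slit_expression_fst[OF assms(1) U(1), symmetric])
    qed
    show ?thesis
      using f smooth_at_slit_fst[OF assms(1,2) f] frechet_derivative_eqI[OF der]
      by (simp add: rho_def x chart_vector_def)
  qed (simp add: rho_def x chart_vector_def)
  moreover have "?\<xi> \<in> ttm M u"
    by (rule chart_vector_in_tangent_space[OF slit_chart_mem[OF U(1)] u])
  ultimately show ?thesis by blast
qed

lemma rho_add: "rho M u (\<xi> + \<zeta>) = rho M u \<xi> + rho M u \<zeta>"
  by (auto simp: rho_def)

text \<open>The vertical part of a preimage under \<open>\<rho>\<close> does not contribute, so \<open>\<rho>\<close> is already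
  surjective on the horizontal space.\<close>

lemma hmap_in_ttm:
  assumes "smooth_manifold M" "regular_connection M D" "u \<in> slit M" "x \<in> fibre M u"
  shows "hmap M D u x \<in> ttm M u"
proof -
  obtain \<xi> where \<xi>: "\<xi> \<in> ttm M u" "rho M u \<xi> = x" using rho_surj[OF assms(1,3,4)] by blast
  obtain \<nu> \<eta> where "\<xi> = \<nu> + \<eta>" "\<nu> \<in> vspace M u" "\<eta> \<in> hspace M D u"
    using assms(2,3) \<xi>(1) unfolding regular_connection_def by blast
  then have "x \<in> rho M u ` hspace M D u"
    using \<xi>(2) by (auto simp: rho_add vspace_def)
  then have "hmap M D u x \<in> hspace M D u" unfolding hmap_def by (rule inv_into_into)
  then show ?thesis by (simp add: hspace_def)
qed

lemma cov_hlift_in_fibre: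
  assumes "smooth_manifold M" "regular_connection M D" "u \<in> slit M" "pi_field M W" "pi_field M X"
  shows "cov M D (hlift_field M D W) X u \<in> fibre M u"
proof -
  have "hmap M D u (W u) \<in> ttm M u"
    using assms by (intro hmap_in_ttm) (auto simp: pi_field_def)
  then show ?thesis
    using assms unfolding regular_connection_def linear_connection_def
    by (simp add: cov_def hlift_field_def)
qed

text \<open>Recurrence sees a tensor only through its values on fibre vectors; the covariant derivatives
  of the arguments are such vectors by the previous lemma.\<close>

lemma recurrent_cong:
  assumes "smooth_manifold M" "regular_connection M D"
    and "\<And>u x y z. u \<in> slit M \<Longrightarrow> x \<in> fibre M u \<Longrightarrow> y \<in> fibre M u \<Longrightarrow> z \<in> fibre M u \<Longrightarrow>
      B u x y z = B' u x y z"
  shows "recurrent M D B \<longleftrightarrow> recurrent M D B'"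
proof -
  have app: "tensor_app M B X Y Z = tensor_app M B' X Y Z"
    if "\<And>u. u \<in> slit M \<Longrightarrow> X u \<in> fibre M u" "\<And>u. u \<in> slit M \<Longrightarrow> Y u \<in> fibre M u"
      "\<And>u. u \<in> slit M \<Longrightarrow> Z u \<in> fibre M u" for X Y Z
    using that assms(3) by (auto simp: tensor_app_def)
  have fib: "X u \<in> fibre M u" if "pi_field M X" "u \<in> slit M" for X u
    using that by (auto simp: pi_field_def)
  have "hcov M D B W X Y Z = hcov M D B' W X Y Z"
    if "pi_field M W" "pi_field M X" "pi_field M Y" "pi_field M Z" for W X Y Z
    unfolding hcov_def using that
    by (simp add: app fib cov_hlift_in_fibre[OF assms(1,2)])
  moreover have "B u (X u) (Y u) (Z u) = B' u (X u) (Y u) (Z u)"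
    if "pi_field M X" "pi_field M Y" "pi_field M Z" "u \<in> slit M" for X Y Z u
    using that by (intro assms(3) fib)
  ultimately show ?thesis unfolding recurrent_def by simp
qed


section \<open>The Finsler metric and the Einstein condition\<close>

lemma deriv_along_line:
  assumes "h differentiable (at z)"
  shows "deriv (\<lambda>t. h (z + t *\<^sub>R e)) 0 = (frechet_derivative h (at z) e :: real)"
proof -
  have "((\<lambda>t::real. z + t *\<^sub>R e) has_derivative (\<lambda>t. t *\<^sub>R e)) (at 0)"
    by (auto intro!: derivative_eq_intros)
  moreover have h: "(h has_derivative frechet_derivative h (at z)) (at (z + 0 *\<^sub>R e))"
    using assms by (simp flip: frechet_derivative_works)
  ultimately have "((\<lambda>t::real. h (z + t *\<^sub>R e)) has_derivative
      (\<lambda>t. frechet_derivative h (at z) (t *\<^sub>R e))) (at 0)"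
    by (rule has_derivative_compose)
  then have "((\<lambda>t::real. h (z + t *\<^sub>R e)) has_derivative (\<lambda>t. frechet_derivative h (at z) e * t)) (at 0)"
    using linear_scale[OF linear_frechet_derivative[OF assms]] by (simp add: mult.commute)
  then show ?thesis by (intro DERIV_imp_deriv) (simp add: has_field_derivative_def)
qed

text \<open>In a chart, the Finsler metric is a second derivative of the coordinate expression of
  \<open>L\<^sup>2\<close>; its linearity in the outer direction is that of the Frechet derivative.\<close>

lemma fmetric_in_chart:
  assumes "smooth_manifold M" "smooth_fun_on (slit_atlas M) (slit M) L"
    and U: "(U, \<phi>) \<in> M" "fst u \<in> U" and u: "u \<in> slit M"
    and fib: "x \<in> fibre M u" "y \<in> fibre M u"
  defines "h \<equiv> \<lambda>z. (L (inv_into (slit_over M U) (slit_chart \<phi>) z))\<^sup>2"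
  defines "h' \<equiv> \<lambda>z. frechet_derivative h (at z) (0, coords \<phi> y)"
  shows "h' differentiable (at (slit_chart \<phi> u))"
    and "fmetric L u x y = frechet_derivative h' (at (slit_chart \<phi> u)) (0, coords \<phi> x) / 2"
proof -
  let ?U = "slit_over M U" and ?\<phi> = "slit_chart \<phi>"
  let ?e = "(0, coords \<phi> y)" and ?d = "(0, coords \<phi> x)"
  define l where "l = L \<circ> inv_into ?U ?\<phi>"
  have h: "h = (\<lambda>z. (l z)\<^sup>2)" by (simp add: h_def l_def)
  have img: "?\<phi> ` ?U = \<phi> ` U \<times> (- {0})" using slit_chart_image[OF assms(1) U(1)] by simp
  have opn: "open (?\<phi> ` ?U)"
    unfolding img using open_chart_image[OF assms(1) U(1)] by (auto intro!: open_Times)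
  have "?U \<inter> slit M = ?U" by auto
  then have l: "smooth_on (?\<phi> ` ?U) l"
    using assms(2) slit_chart_mem[OF U(1)] unfolding smooth_fun_on_def l_def by fastforce
  have h_der: "(h has_derivative (\<lambda>v. 2 * l z * frechet_derivative l (at z) v)) (at z)"
    if "z \<in> ?\<phi> ` ?U" for z
  proof -
    have "(l has_derivative frechet_derivative l (at z)) (at z)"
      using smooth_on_differentiable[OF l that] by (simp flip: frechet_derivative_works)
    then have "((\<lambda>z. (l z)\<^sup>2) has_derivative (\<lambda>v. 2 * l z * frechet_derivative l (at z) v)) (at z)"
      by (auto intro!: derivative_eq_intros)
    then show ?thesis by (simp add: h)
  qed
  have zu: "?\<phi> u \<in> ?\<phi> ` ?U" using U u by blast
  have "(\<lambda>z. 2 * l z * frechet_derivative l (at z) ?e) differentiable (at (?\<phi> u))"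
    using smooth_on_differentiable[OF l zu] smooth_on_twice_differentiable[OF l zu]
    by (intro differentiable_mult differentiable_const)
  then obtain H where "((\<lambda>z. 2 * l z * frechet_derivative l (at z) ?e) has_derivative H) (at (?\<phi> u))"
    unfolding differentiable_def by blast
  then have "(h' has_derivative H) (at (?\<phi> u))"
    using opn zu
    by (rule has_derivative_transform_within_open) (simp add: h'_def frechet_derivative_eqI[OF h_der])
  then show h': "h' differentiable (at (?\<phi> u))" unfolding differentiable_def by blast

  have L2: "(L (fst u, snd u + s *\<^sub>R x + t *\<^sub>R y))\<^sup>2 = h (?\<phi> u + s *\<^sub>R ?d + t *\<^sub>R ?e)"
    if "?\<phi> u + s *\<^sub>R ?d + t *\<^sub>R ?e \<in> ?\<phi> ` ?U" for s t
  proof -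
    let ?u = "(fst u, snd u + s *\<^sub>R x + t *\<^sub>R y)"
    have eq: "?\<phi> ?u = ?\<phi> u + s *\<^sub>R ?d + t *\<^sub>R ?e"
      by (simp add: slit_chart_def coords_linear)
    then have "coords \<phi> (snd ?u) \<noteq> 0"
      using that unfolding img by (auto simp: slit_chart_def)
    then have "snd ?u \<noteq> 0" by (metis coords_0)
    moreover have "snd ?u \<in> tangent_space M (fst u)"
      using u fib tangent_space_closed[OF assms(1)] by (auto simp: slit_def)
    ultimately have "?u \<in> ?U" using u U by (auto simp: slit_def)
    then show ?thesis
      unfolding eq[symmetric] h_def using inj_on_slit_chart[OF assms(1) U(1)] by (simp add: inv_into_f_f)
  qed
  have near: "\<forall>\<^sub>F t::real in nhds 0. z + t *\<^sub>R e \<in> ?\<phi> ` ?U" if "z \<in> ?\<phi> ` ?U" for z e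
  proof -
    have "isCont (\<lambda>t::real. z + t *\<^sub>R e) 0" by (intro continuous_intros)
    then have "((\<lambda>t::real. z + t *\<^sub>R e) \<longlongrightarrow> z) (nhds 0)"
      by (simp add: isCont_def tendsto_nhds_iff)
    then show ?thesis using opn that by (rule topological_tendstoD)
  qed
  have "deriv (\<lambda>t. (L (fst u, snd u + s *\<^sub>R x + t *\<^sub>R y))\<^sup>2) 0 = h' (?\<phi> u + s *\<^sub>R ?d)"
    if s: "?\<phi> u + s *\<^sub>R ?d \<in> ?\<phi> ` ?U" for s
  proof -
    have "deriv (\<lambda>t. (L (fst u, snd u + s *\<^sub>R x + t *\<^sub>R y))\<^sup>2) 0
        = deriv (\<lambda>t. h (?\<phi> u + s *\<^sub>R ?d + t *\<^sub>R ?e)) 0"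
      by (intro deriv_cong_ev eventually_mono[OF near[OF s, of ?e]] L2) auto
    also have "\<dots> = h' (?\<phi> u + s *\<^sub>R ?d)"
      unfolding h'_def using h_der[OF s] by (intro deriv_along_line) (auto simp: differentiable_def)
    finally show ?thesis .
  qed
  then have "deriv (\<lambda>s. deriv (\<lambda>t. (L (fst u, snd u + s *\<^sub>R x + t *\<^sub>R y))\<^sup>2) 0) 0
      = deriv (\<lambda>s. h' (?\<phi> u + s *\<^sub>R ?d)) 0"
    by (intro deriv_cong_ev eventually_mono[OF near[OF zu, of ?d]]) auto
  then show "fmetric L u x y = frechet_derivative h' (at (?\<phi> u)) ?d / 2"
    unfolding fmetric_def deriv_along_line[OF h'] by simp
qed

lemma fmetric_linear_left:
  fixes M :: "('a, 'e::euclidean_space) atlas"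
  assumes "finsler_manifold M L" "u \<in> slit M" "x \<in> fibre M u" "x' \<in> fibre M u" "y \<in> fibre M u"
  shows "fmetric L u (x + x') y = fmetric L u x y + fmetric L u x' y"
    and "fmetric L u (c *\<^sub>R x) y = c * fmetric L u x y"
proof -
  have M: "smooth_manifold M" and L: "smooth_fun_on (slit_atlas M) (slit M) L"
    using assms(1) by (auto simp: finsler_manifold_def)
  obtain U \<phi> where U: "(U, \<phi>) \<in> M" "fst u \<in> U"
    using assms(3) by (auto simp: tangent_space_chart_vector)
  note g = fmetric_in_chart[OF M L U assms(2)]
  note lin = linear_frechet_derivative[OF g(1)[OF assms(3,5)]]
  have pair: "(0::'e, a + b) = (0, a) + (0, b)" "(0::'e, c *\<^sub>R a) = c *\<^sub>R (0, a)"
    for a b :: 'e and c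
    by simp_all
  show "fmetric L u (x + x') y = fmetric L u x y + fmetric L u x' y"
    and "fmetric L u (c *\<^sub>R x) y = c * fmetric L u x y"
    using assms(3-5) tangent_space_closed[OF M assms(3,4)]
    by (simp_all only: g(2) coords_linear pair linear_add[OF lin] linear_scale[OF lin])
       (simp_all add: add_divide_distrib)
qed

text \<open>Positive definiteness makes the metric nondegenerate, so the vector representing
  \<open>Ric(x, -) = c g(x, -)\<close> can only be \<open>c x\<close>.\<close>

lemma Ric_op_einstein:
  assumes fin: "finsler_manifold M L" and u: "u \<in> slit M" and x: "x \<in> fibre M u"
    and Ric: "\<And>y. y \<in> fibre M u \<Longrightarrow> Ric M D u x y = c * fmetric L u x y"
  shows "Ric_op M L D u x = c *\<^sub>R x"
  unfolding Ric_op_def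
proof (rule the_equality)
  have M: "smooth_manifold M" using fin by (simp add: finsler_manifold_def)
  note closed = tangent_space_closed[OF M]
  show c: "c *\<^sub>R x \<in> fibre M u \<and> (\<forall>y\<in>fibre M u. fmetric L u (c *\<^sub>R x) y = Ric M D u x y)"
    using closed[OF x x] fmetric_linear_left(2)[OF fin u x x] Ric by simp
  fix z assume z: "z \<in> fibre M u \<and> (\<forall>y\<in>fibre M u. fmetric L u z y = Ric M D u x y)"
  let ?d = "z + (-1) *\<^sub>R (c *\<^sub>R x)"
  have m: "(-1) *\<^sub>R (c *\<^sub>R x) \<in> fibre M u" using c closed(2) by blast
  have d: "?d \<in> fibre M u" using z m closed(1) by blast
  have "fmetric L u ?d ?d = fmetric L u z ?d - fmetric L u (c *\<^sub>R x) ?d"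
    using c z fmetric_linear_left(1)[OF fin u _ m d]
      fmetric_linear_left(2)[OF fin u _ _ d, of "c *\<^sub>R x" "c *\<^sub>R x" "-1"] by simp
  also have "\<dots> = 0" using c z d by simp
  finally have "?d = 0"
    using fin u d unfolding finsler_manifold_def by (metis less_irrefl)
  then show "z = c *\<^sub>R x" by simp
qed

theorem theorem3p3:
  fixes M :: "('a, 'e::euclidean_space) atlas"
    and L :: "'a tm \<Rightarrow> real"
    and D :: "'a connection"
  assumes finsler: "finsler_manifold M L"
    and dim: "DIM('e) \<ge> 3"
    and cartan: "cartan_connection M L D"
    and Ric_nonzero: "\<exists>u\<in>slit M. \<exists>x\<in>fibre M u. \<exists>y\<in>fibre M u. Ric M D u x y \<noteq> 0"
    and einstein: "\<forall>u\<in>slit M. \<forall>x\<in>fibre M u. \<forall>y\<in>fibre M u.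
      Ric M D u x y = hscalar M L D u / real DIM('e) * fmetric L u x y"
  shows "(concircularly_recurrent M L D \<longleftrightarrow> projectively_recurrent M D) \<and>
         (projectively_recurrent M D \<longleftrightarrow> m_projectively_recurrent M L D)"
proof -
  have M: "smooth_manifold M" and reg: "regular_connection M D"
    using finsler cartan by (auto simp: finsler_manifold_def cartan_connection_def)
  have CP: "concircular M L D u x y z = projective M D u x y z"
    and PH: "projective M D u x y z = m_projective M L D u x y z"
    if u: "u \<in> slit M" and fib: "x \<in> fibre M u" "y \<in> fibre M u" "z \<in> fibre M u" for u x y z
  proof -
    define c where "c = hscalar M L D u / real DIM('e)"
    define m where "m = real DIM('e) - 1"
    have Ric: "Ric M D u a b = c * fmetric L u a b" if "a \<in> fibre M u" "b \<in> fibre M u" for a b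
      using einstein u that by (simp add: c_def)
    have op: "Ric_op M L D u a = c *\<^sub>R a" if "a \<in> fibre M u" for a
      using Ric that by (intro Ric_op_einstein[OF finsler u])
    have r: "hscalar M L D u / (real DIM('e) * (real DIM('e) - 1)) = c / m"
      by (simp add: c_def m_def)
    show "concircular M L D u x y z = projective M D u x y z"
      unfolding concircular_def projective_def G_tensor_def r
      using fib by (simp add: Ric m_def scaleR_diff_right)
    have dbl: "(1 / (2 * m)) *\<^sub>R (v + v) = (1 / m) *\<^sub>R v" for v :: "'a tangent"
      by (simp flip: scaleR_2)
    have "Ric M D u x z *\<^sub>R y - Ric M D u y z *\<^sub>R x
          + fmetric L u x z *\<^sub>R Ric_op M L D u y - fmetric L u y z *\<^sub>R Ric_op M L D u x
        = (Ric M D u x z *\<^sub>R y - Ric M D u y z *\<^sub>R x)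
          + (Ric M D u x z *\<^sub>R y - Ric M D u y z *\<^sub>R x)"
      using fib by (simp add: Ric op mult.commute)
    then show "projective M D u x y z = m_projective M L D u x y z"
      unfolding projective_def m_projective_def m_def[symmetric] by (simp only: dbl)
  qed
  have "recurrent M D (concircular M L D) \<longleftrightarrow> recurrent M D (projective M D)"
    "recurrent M D (projective M D) \<longleftrightarrow> recurrent M D (m_projective M L D)"
    by (rule recurrent_cong[OF M reg]; simp only: CP PH)+
  then show ?thesis
    by (simp add: concircularly_recurrent_def projectively_recurrent_def m_projectively_recurrent_def)
qed

end
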